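(* Let $D$ be a double poset on a finite set $N$ and let $\mathfrak{G}\subseteq\operatorname{Aut}(D)$. Then: (1) for each $\mathfrak{g}\in\mathfrak{G}$, $\Omega(D,\mathfrak{G},\mathbf{x};\mathfrak{g})=\sum_{C}M_{\alpha(C)}$, the sum over $D$-set compositions $C$ with $\mathfrak{g}C=C$; (2) $\Omega(D,\mathfrak{G},\mathbf{x})=\sum_{\alpha\models|N|}\chi_{\alpha,D}M_\alpha$; (3) $\Omega(D,\mathfrak{G},x)=\sum_{\alpha\models|N|}\chi_{\alpha,D}\binom{x}{\ell(\alpha)}$.
   Context: Double poset $D=(N,\le_1,\le_2)$; $\operatorname{Aut}(D)$ = bijections preserving both orders. A $D$-partition is $f:N\to\{1,2,\dots\}$ with $i\le_1 j\Rightarrow f(i)\le f(j)$ and ($i<_1 j$ and $j<_2 i$) $\Rightarrow f(i)<f(j)$. $\Omega(D,\mathfrak{G},\mathbf{x};\mathfrak{g})=\sum_f\prod_v x_{f(v)}$ over $D$-partitions with $f\circ\mathfrak{g}=f$; for positive integers $n$, $\Omega(D,\mathfrak{G},n)$ is the permutation character of $\mathfrak{G}$ on the set of $D$-partitions with values in $\{1,\dots,n\}$, and $\Omega(D,\mathfrak{G},x)$ denotes this as a function of $x$ (identity (3) is meant at all positive integers $x$). A set composition of $N$ is a sequence $C=C_1|\cdots|C_k$ of disjoint nonempty blocks with union $N$; its type is $\alpha(C)=(|C_1|,\dots,|C_k|)$, $\ell(\alpha)$ is the number of parts, and $\mathfrak{g}C=\mathfrak{g}(C_1)|\cdots|\mathfrak{g}(C_k)$.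 An inversion is a pair $(m,m')$ with $m<_1 m'$ and $m'<_2 m$. $C$ is a $D$-set composition if each $C_1\cup\cdots\cup C_i$ is a down-set of $\le_1$ and no block contains an inversion. $\chi_{\alpha,D}$ is the permutation character of $\mathfrak{G}$ acting on the set $X_{\alpha,D}$ of $D$-set compositions of type $\alpha$. $M_\alpha$ are monomial quasisymmetric functions. *)

theory Defs
  imports Complex_Main
    "HOL-Algebra.Bij"
    "HOL-Library.Poly_Mapping"
    "HOL-Library.Function_Algebras"
    "HOL-Library.Disjoint_Sets"
begin

subsection \<open>Double posets\<close>

record 'a double_poset =
  points :: "'a set"
  ord1 :: "'a rel"
  ord2 :: "'a rel"

definition is_double_poset :: "'a double_poset \<Rightarrow> bool" where
  "is_double_poset D \<longleftrightarrow>
     partial_order_on (points D) (ord1 D) \<and> partial_order_on (points D) (ord2 D)"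

definition less1 :: "'a double_poset \<Rightarrow> 'a \<Rightarrow> 'a \<Rightarrow> bool" where
  "less1 D i j \<longleftrightarrow> (i, j) \<in> ord1 D \<and> i \<noteq> j"

definition less2 :: "'a double_poset \<Rightarrow> 'a \<Rightarrow> 'a \<Rightarrow> bool" where
  "less2 D i j \<longleftrightarrow> (i, j) \<in> ord2 D \<and> i \<noteq> j"

definition inversion :: "'a double_poset \<Rightarrow> 'a \<Rightarrow> 'a \<Rightarrow> bool" where
  "inversion D m m' \<longleftrightarrow> less1 D m m' \<and> less2 D m' m"

text \<open>Elements of \<open>Bij N\<close> are extensional, i.e. undefined outside \<open>N\<close>, so that
  they are determined by their values on \<open>N\<close>.\<close>

definition Aut :: "'a double_poset \<Rightarrow> ('a \<Rightarrow> 'a) set" where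
  "Aut D = {g \<in> Bij (points D).
     (\<forall>i j. (i, j) \<in> ord1 D \<longrightarrow> (g i, g j) \<in> ord1 D) \<and>
     (\<forall>i j. (i, j) \<in> ord2 D \<longrightarrow> (g i, g j) \<in> ord2 D)}"

subsection \<open>Formal power series in $x_1, x_2, \dots$\<close>

text \<open>Monomials are exponent vectors \<open>nat \<Rightarrow>\<^sub>0 nat\<close>; a power series assigns a coefficient to
  each of them, and addition is pointwise. The index \<open>0\<close> is never used. Polynomials are the
  finitely supported series, and \<open>*\<close> on them is the convolution product.\<close>

type_synonym polynom = "(nat \<Rightarrow>\<^sub>0 nat) \<Rightarrow>\<^sub>0 complex"
type_synonym series = "(nat \<Rightarrow>\<^sub>0 nat) \<Rightarrow> complex"

definition var :: "nat \<Rightarrow> polynom" where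
  "var i = Poly_Mapping.single (Poly_Mapping.single i 1) 1"

text \<open>The sum of a possibly infinite family of polynomials, taken coefficientwise. It is meant
  for families in which each exponent vector has a nonzero coefficient in only finitely many
  members. This holds for both families below: they consist of monomials, and an
  exponent vector determines, up to finitely many choices, the indices occurring in it.\<close>

definition formal_sum :: "'i set \<Rightarrow> ('i \<Rightarrow> polynom) \<Rightarrow> series" where
  "formal_sum I F =
     (\<lambda>m. \<Sum>i \<in> {i \<in> I. Poly_Mapping.lookup (F i) m \<noteq> 0}. Poly_Mapping.lookup (F i) m)"

definition scale_series :: "complex \<Rightarrow> series \<Rightarrow> series"  (infixr \<open>*\<^sub>s\<close> 75) where
  "c *\<^sub>s F = (\<lambda>m. c * F m)"

definition compositions :: "nat \<Rightarrow> nat list set" where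
  "compositions n = {\<alpha>. 0 \<notin> set \<alpha> \<and> sum_list \<alpha> = n}"

text \<open>$M_\alpha = \sum_{i_1 < \dots < i_k} x_{i_1}^{\alpha_1} \cdots x_{i_k}^{\alpha_k}$.\<close>

definition monomial_qsym :: "nat list \<Rightarrow> series" where
  "monomial_qsym \<alpha> =
     formal_sum {is. length is = length \<alpha> \<and> sorted_wrt (<) is \<and> (\<forall>i \<in> set is. 1 \<le> i)}
       (\<lambda>is. \<Prod>j < length \<alpha>. var (is ! j) ^ (\<alpha> ! j))"

subsection \<open>Permutation characters\<close>

text \<open>The trace of the permutation matrix of \<open>\<phi> g\<close>, whose \<open>(x, y)\<close> entry is \<open>1\<close> if
  \<open>x = \<phi> g y\<close> and \<open>0\<close> otherwise.\<close>

definition perm_char :: "('g \<Rightarrow> 'x \<Rightarrow> 'x) \<Rightarrow> 'x set \<Rightarrow> 'g \<Rightarrow> complex" where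
  "perm_char \<phi> X g = (\<Sum>x \<in> X. if x = \<phi> g x then 1 else 0)"

subsection \<open>$D$-partitions\<close>

definition D_partitions :: "'a double_poset \<Rightarrow> ('a \<Rightarrow> nat) set" where
  "D_partitions D = {f \<in> points D \<rightarrow>\<^sub>E {1..}.
     (\<forall>i j. (i, j) \<in> ord1 D \<longrightarrow> f i \<le> f j) \<and>
     (\<forall>i j. less1 D i j \<and> less2 D j i \<longrightarrow> f i < f j)}"

text \<open>\<open>\<Omega> D g\<close> is $\Omega(D, G, \mathbf{x}; g)$; the function \<open>\<Omega> D\<close>, considered on \<open>G\<close>,
  is $\Omega(D, G, \mathbf{x})$.\<close>

definition \<Omega> :: "'a double_poset \<Rightarrow> ('a \<Rightarrow> 'a) \<Rightarrow> series" where
  "\<Omega> D g = formal_sum {f \<in> D_partitions D. compose (points D) f g = f}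
     (\<lambda>f. \<Prod>v \<in> points D. var (f v))"

definition D_partitions_upto :: "'a double_poset \<Rightarrow> nat \<Rightarrow> ('a \<Rightarrow> nat) set" where
  "D_partitions_upto D n = {f \<in> D_partitions D. \<forall>v \<in> points D. f v \<in> {1..n}}"

text \<open>Permutations act (from the left) on functions by $g \cdot f = f \circ g^{-1}$.\<close>

definition act_fun :: "'a double_poset \<Rightarrow> ('a \<Rightarrow> 'a) \<Rightarrow> ('a \<Rightarrow> nat) \<Rightarrow> ('a \<Rightarrow> nat)" where
  "act_fun D g f = compose (points D) f (inv\<^bsub>BijGroup (points D)\<^esub> g)"

definition \<Omega>_poly :: "'a double_poset \<Rightarrow> nat \<Rightarrow> ('a \<Rightarrow> 'a) \<Rightarrow> complex" where
  "\<Omega>_poly D n = perm_char (act_fun D) (D_partitions_upto D n)"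

subsection \<open>$D$-set compositions\<close>

definition set_compositions :: "'a set \<Rightarrow> 'a set list set" where
  "set_compositions N = {C. distinct C \<and> partition_on N (set C)}"

definition comp_type :: "'a set list \<Rightarrow> nat list" where
  "comp_type C = map card C"

definition act_comp :: "('a \<Rightarrow> 'a) \<Rightarrow> 'a set list \<Rightarrow> 'a set list" where
  "act_comp g C = map (\<lambda>B. g ` B) C"

definition down_set1 :: "'a double_poset \<Rightarrow> 'a set \<Rightarrow> bool" where
  "down_set1 D S \<longleftrightarrow> S \<subseteq> points D \<and> (\<forall>i j. j \<in> S \<and> (i, j) \<in> ord1 D \<longrightarrow> i \<in> S)"

definition D_set_compositions :: "'a double_poset \<Rightarrow> 'a set list set" where
  "D_set_compositions D = {C \<in> set_compositions (points D).
     (\<forall>i \<le> length C. down_set1 D (\<Union>(set (take i C)))) \<and>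
     (\<forall>B \<in> set C. \<not> (\<exists>m \<in> B. \<exists>m' \<in> B. inversion D m m'))}"

definition D_set_compositions_of_type :: "'a double_poset \<Rightarrow> nat list \<Rightarrow> 'a set list set" where
  "D_set_compositions_of_type D \<alpha> = {C \<in> D_set_compositions D. comp_type C = \<alpha>}"

definition D_char :: "'a double_poset \<Rightarrow> nat list \<Rightarrow> ('a \<Rightarrow> 'a) \<Rightarrow> complex" where
  "D_char D \<alpha> = perm_char act_comp (D_set_compositions_of_type D \<alpha>)"

end

theory Submission
  imports Defs
begin

text \<open>A D-partition \<open>f\<close> is the same thing as the sequence of its level sets, ordered by value, which
  is a D-set composition \<open>C\<close>, together with the strictly increasing sequence of its values. The
  D-partitions with a given \<open>C\<close> contribute exactly the monomials of \<open>M\<close> for the type of \<open>C\<close>, and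
  the ones bounded by \<open>n\<close> correspond to the subsets of \<open>{1..n}\<close> of size \<open>length C\<close>. Since \<open>f\<close> is
  fixed by \<open>g\<close> if and only if \<open>C\<close> is, all three identities follow by grouping the fixed
  D-partitions by \<open>C\<close>, and then the fixed \<open>C\<close> by type.\<close>

subsection \<open>Formal sums\<close>

lemma formal_sum_reindex:
  assumes bij: "bij_betw h I J" and eq: "\<And>i. i \<in> I \<Longrightarrow> F i = G (h i)"
  shows "formal_sum I F = formal_sum J G"
  unfolding formal_sum_def
proof
  fix m
  let ?I = "{i \<in> I. Poly_Mapping.lookup (F i) m \<noteq> 0}"
  let ?J = "{j \<in> J. Poly_Mapping.lookup (G j) m \<noteq> 0}"
  have "bij_betw h ?I ?J"
    using bij by (rule bij_betw_Collect) (simp add: eq)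
  then have "(\<Sum>i\<in>?I. Poly_Mapping.lookup (G (h i)) m) = (\<Sum>j\<in>?J. Poly_Mapping.lookup (G j) m)"
    by (rule sum.reindex_bij_betw)
  then show "(\<Sum>i\<in>?I. Poly_Mapping.lookup (F i) m) = (\<Sum>j\<in>?J. Poly_Mapping.lookup (G j) m)"
    by (simp add: eq)
qed

lemma sum_fun_apply: "(\<Sum>i\<in>A. f i) x = (\<Sum>i\<in>A. f i x)"
  by (induction A rule: infinite_finite_induct) auto

text \<open>Each coefficient is a finite sum by \<open>fin\<close>, so it can be grouped by the
  value of \<open>h\<close>. The finiteness matters because a \<open>sum\<close> over an infinite
  set is 0 by convention.\<close>

lemma formal_sum_group:
  assumes fin: "\<And>m. finite {i \<in> I. Poly_Mapping.lookup (F i) m \<noteq> 0}"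
    and T: "finite T" "h ` I \<subseteq> T"
  shows "formal_sum I F = (\<Sum>t\<in>T. formal_sum {i \<in> I. h i = t} F)"
proof
  fix m
  let ?S = "{i \<in> I. Poly_Mapping.lookup (F i) m \<noteq> 0}"
  have "formal_sum I F m = (\<Sum>t\<in>T. \<Sum>i\<in>{i \<in> ?S. h i = t}. Poly_Mapping.lookup (F i) m)"
    unfolding formal_sum_def using T(2) by (intro sum.group[OF fin T(1), symmetric]) blast
  also have "\<dots> = (\<Sum>t\<in>T. formal_sum {i \<in> I. h i = t} F m)"
    unfolding formal_sum_def by (intro sum.cong refl) blast
  finally show "formal_sum I F m = (\<Sum>t\<in>T. formal_sum {i \<in> I. h i = t} F) m"
    by (simp add: sum_fun_apply)
qed

text \<open>Exponent vectors add when variables are multiplied, so the product is a single monomial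
  with coefficient 1. For infinite \<open>A\<close> both sides are 1.\<close>

lemma prod_var:
  "(\<Prod>v\<in>A. var (f v)) = Poly_Mapping.single (\<Sum>v\<in>A. Poly_Mapping.single (f v) 1) 1"
  by (induction A rule: infinite_finite_induct) (auto simp: var_def mult_single)

lemma lookup_sum_single_pos:
  assumes "finite A" "v \<in> A"
  shows "Poly_Mapping.lookup (\<Sum>v\<in>A. Poly_Mapping.single (f v) (1::nat)) (f v) > 0"
  using assms by (simp add: sum.remove lookup_add)

text \<open>This makes the series over D-partitions summable: if the monomial of \<open>f\<close> is
  \<open>m\<close>, every value of \<open>f\<close> is the index of a variable occurring in
  \<open>m\<close>, and there are only finitely many functions from \<open>N\<close> to these
  indices.\<close>

lemma finite_prod_var_fiber:
  assumes "finite N"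
  shows "finite {f \<in> N \<rightarrow>\<^sub>E B. Poly_Mapping.lookup (\<Prod>v\<in>N. var (f v)) m \<noteq> 0}"
proof (rule finite_subset)
  show "{f \<in> N \<rightarrow>\<^sub>E B. Poly_Mapping.lookup (\<Prod>v\<in>N. var (f v)) m \<noteq> 0}
      \<subseteq> N \<rightarrow>\<^sub>E Poly_Mapping.keys m"
  proof
    fix f assume "f \<in> {f \<in> N \<rightarrow>\<^sub>E B. Poly_Mapping.lookup (\<Prod>v\<in>N. var (f v)) m \<noteq> 0}"
    then have f: "f \<in> N \<rightarrow>\<^sub>E B" and "m = (\<Sum>v\<in>N. Poly_Mapping.single (f v) 1)"
      by (auto simp: prod_var lookup_single when_def split: if_splits)
    then have "f v \<in> Poly_Mapping.keys m" if "v \<in> N" for v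
      using lookup_sum_single_pos[OF assms that, of f] by (simp add: in_keys_iff)
    then show "f \<in> N \<rightarrow>\<^sub>E Poly_Mapping.keys m"
      using f by auto
  qed
qed (use assms in \<open>simp add: finite_PiE\<close>)

subsection \<open>Set compositions\<close>

lemma set_compositionsD:
  assumes "C \<in> set_compositions N"
  shows "\<Union>(set C) = N"
    and "\<And>j. j < length C \<Longrightarrow> C ! j \<noteq> {}"
    and "\<And>i j v. i < length C \<Longrightarrow> j < length C \<Longrightarrow> v \<in> C ! i \<Longrightarrow> v \<in> C ! j \<Longrightarrow> i = j"
proof -
  have d: "distinct C" and p: "partition_on N (set C)"
    using assms by (auto simp: set_compositions_def)
  show "\<Union>(set C) = N" using p by (simp add: partition_on_def)
  show "C ! j \<noteq> {}" if "j < length C" for j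
    using p nth_mem[OF that] by (auto simp: partition_on_def)
  show "i = j" if "i < length C" "j < length C" "v \<in> C ! i" "v \<in> C ! j" for i j v
  proof -
    have "C ! i = C ! j"
      using p that disjointD[OF partition_onD2[OF p], of "C ! i" "C ! j"] nth_mem by blast
    then show ?thesis using d that by (simp add: nth_eq_iff_index_eq)
  qed
qed

lemma set_compositions_ex1_block:
  assumes "C \<in> set_compositions N" "v \<in> N"
  shows "\<exists>!j. j < length C \<and> v \<in> C ! j"
proof -
  have "v \<in> \<Union>(set C)" using assms set_compositionsD(1) by blast
  then show ?thesis
    using set_compositionsD(3)[OF assms(1)] by (auto simp: in_set_conv_nth)
qed

lemma finite_set_compositions:
  assumes "finite N"
  shows "finite (set_compositions N)"
proof (rule finite_subset)
  show "set_compositions N \<subseteq> {C. set C \<subseteq> Pow N \<and> distinct C}"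
    by (auto simp: set_compositions_def partition_on_def)
  show "finite {C. set C \<subseteq> Pow N \<and> distinct C}"
    using assms by (simp add: finite_subset_distinct)
qed

lemma comp_type_in_compositions:
  assumes "finite N" and C: "C \<in> set_compositions N"
  shows "comp_type C \<in> compositions (card N)"
proof -
  have d: "distinct C" and p: "partition_on N (set C)"
    using C by (auto simp: set_compositions_def)
  have fin: "finite B" if "B \<in> set C" for B
    using p that assms(1) by (auto simp: partition_on_def intro: finite_subset)
  have "sum_list (map card C) = (\<Sum>B\<in>set C. card B)"
    using d by (simp add: sum_list_distinct_conv_sum_set)
  also have "\<dots> = card N"
    using card_Union_disjoint[of "set C"] p fin by (simp add: partition_on_def pairwise_def disjoint_def disjnt_def)
  finally show ?thesis
    using p fin by (auto simp: compositions_def comp_type_def partition_on_def)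
qed

text \<open>All parts are positive, so the length of a composition is at most its sum, and so is
  each part.\<close>

lemma finite_compositions: "finite (compositions n)"
proof (rule finite_subset)
  have "length \<alpha> \<le> sum_list \<alpha>" if "0 \<notin> set \<alpha>" for \<alpha> :: "nat list"
    using that
  proof (induction \<alpha>)
    case (Cons a \<alpha>)
    then have "a \<ge> 1" "length \<alpha> \<le> sum_list \<alpha>" by auto
    then show ?case by simp
  qed simp
  then show "compositions n \<subseteq> {\<alpha>. set \<alpha> \<subseteq> {..n} \<and> length \<alpha> \<le> n}"
    by (auto simp: compositions_def member_le_sum_list)
qed (simp add: finite_lists_length_le)

subsection \<open>Level sets\<close>

text \<open>Only attained values index the blocks, so no block is empty. The actual values are
  forgotten; they are recorded separately by the sorted list of the image of
  \<open>f\<close>.\<close>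

definition level_sets :: "'a set \<Rightarrow> ('a \<Rightarrow> nat) \<Rightarrow> 'a set list" where
  "level_sets N f = map (\<lambda>i. {v \<in> N. f v = i}) (sorted_list_of_set (f ` N))"

lemma level_sets_in_set_compositions:
  assumes "finite N"
  shows "level_sets N f \<in> set_compositions N"
proof -
  have "inj_on (\<lambda>i. {v \<in> N. f v = i}) (f ` N)"
    by (auto simp: inj_on_def)
  then show ?thesis
    using assms
    by (auto simp: set_compositions_def level_sets_def distinct_map partition_on_def disjoint_def)
qed

text \<open>Since a composition is an ordered list, fixing it means mapping each level set onto
  itself, not merely permuting the level sets. This amounts to \<open>f (g v) = f v\<close> on
  \<open>N\<close>; extensionality of \<open>f\<close> turns that into an equality of
  functions.\<close>

lemma act_comp_level_sets:
  assumes "finite N" "f \<in> extensional N" "g \<in> Bij N"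
  shows "act_comp g (level_sets N f) = level_sets N f \<longleftrightarrow> compose N f g = f"
proof -
  have g: "bij_betw g N N" using assms(3) by (simp add: Bij_def)
  have "act_comp g (level_sets N f) = level_sets N f \<longleftrightarrow>
      (\<forall>v\<in>N. g ` {u \<in> N. f u = f v} = {u \<in> N. f u = f v})"
    using assms(1) by (simp add: act_comp_def level_sets_def)
  also have "\<dots> \<longleftrightarrow> (\<forall>v\<in>N. f (g v) = f v)"
  proof (intro iffI ballI)
    fix v assume "\<forall>v\<in>N. g ` {u \<in> N. f u = f v} = {u \<in> N. f u = f v}" and v: "v \<in> N"
    then have "g ` {u \<in> N. f u = f v} = {u \<in> N. f u = f v}" by blast
    moreover have "g v \<in> g ` {u \<in> N. f u = f v}" using v by blast
    ultimately show "f (g v) = f v" by blast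
  next
    fix v assume inv: "\<forall>v\<in>N. f (g v) = f v" and v: "v \<in> N"
    show "g ` {u \<in> N. f u = f v} = {u \<in> N. f u = f v}"
    proof
      show "g ` {u \<in> N. f u = f v} \<subseteq> {u \<in> N. f u = f v}"
        using inv bij_betwE[OF g] by auto
      \<comment> \<open>A point of the level set has a preimage under \<open>g\<close> in
        \<open>N\<close>, and invariance puts that preimage in the same level set.\<close>
      show "{u \<in> N. f u = f v} \<subseteq> g ` {u \<in> N. f u = f v}"
        using inv bij_betw_imp_surj_on[OF g] by force
    qed
  qed
  also have "\<dots> \<longleftrightarrow> compose N f g = f"
    using assms(2) by (auto simp: compose_def fun_eq_iff extensional_def)
  finally show ?thesis .
qed

text \<open>This recovers the pair of \<open>C\<close> and \<open>xs\<close> from the function built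
  out of it. Nonempty blocks ensure that every entry of \<open>xs\<close> is attained, and distinct
  entries keep different blocks in different level sets.\<close>

lemma sorted_list_of_set_image_of_blocks:
  fixes xs :: "nat list"
  assumes C: "C \<in> set_compositions N" and len: "length xs = length C"
    and f: "\<And>j v. j < length C \<Longrightarrow> v \<in> C ! j \<Longrightarrow> f v = xs ! j"
    and sorted: "sorted_wrt (<) xs"
  shows "sorted_list_of_set (f ` N) = xs" and "level_sets N f = C"
proof -
  have eq: "f ` N = set xs"
  proof
    show "f ` N \<subseteq> set xs"
    proof (rule image_subsetI)
      fix v assume "v \<in> N"
      then obtain j where "j < length C" "v \<in> C ! j" using set_compositions_ex1_block[OF C] by blast
      then show "f v \<in> set xs" using f len by simp
    qed
    show "set xs \<subseteq> f ` N"
    proof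
      fix i assume "i \<in> set xs"
      then obtain j where j: "j < length C" "xs ! j = i" using len by (auto simp: in_set_conv_nth)
      then obtain v where v: "v \<in> C ! j" using set_compositionsD(2)[OF C] by blast
      then have "v \<in> N" using set_compositionsD(1)[OF C] j by auto
      then show "i \<in> f ` N" using f[OF j(1) v] j(2) by auto
    qed
  qed
  have dist: "distinct xs" using sorted by (simp add: strict_sorted_iff)
  show s: "sorted_list_of_set (f ` N) = xs"
    using sorted by (simp add: eq sorted_list_of_set.idem_if_sorted_distinct strict_sorted_iff)
  show "level_sets N f = C"
  proof (rule nth_equalityI)
    show "length (level_sets N f) = length C" by (simp add: level_sets_def s len)
    fix j assume "j < length (level_sets N f)"
    then have j: "j < length C" by (simp add: level_sets_def s len)
    have "{v \<in> N. f v = xs ! j} = C ! j"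
    proof safe
      fix v assume v: "v \<in> N" "f v = xs ! j"
      then obtain j' where j': "j' < length C" "v \<in> C ! j'"
        using set_compositions_ex1_block[OF C] by blast
      then have "xs ! j' = xs ! j" using f v by simp
      then show "v \<in> C ! j" using dist j j' len by (simp add: nth_eq_iff_index_eq)
    next
      fix v assume v: "v \<in> C ! j"
      then show "v \<in> N" using set_compositionsD(1)[OF C] j by auto
      show "f v = xs ! j" using f j v by blast
    qed
    then show "level_sets N f ! j = C ! j" using j by (simp add: level_sets_def s len)
  qed
qed

lemma f_eq_nth_level:
  assumes "finite N" and v: "v \<in> level_sets N f ! j" and j: "j < length (level_sets N f)"
  shows "f v = sorted_list_of_set (f ` N) ! j"
  using assms by (simp add: level_sets_def)

text \<open>On block \<open>j\<close> the function is constant, so this block contributes one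
  variable raised to the size of the block. The right-hand side is written in the shape of the
  summand of \<open>monomial_qsym\<close>.\<close>

lemma prod_var_level_sets:
  fixes f :: "'a \<Rightarrow> nat"
  assumes N: "finite N"
  defines "C \<equiv> level_sets N f"
  shows "(\<Prod>v\<in>N. var (f v)) =
    (\<Prod>j < length (comp_type C). var (sorted_list_of_set (f ` N) ! j) ^ (comp_type C ! j))"
proof -
  have C: "C \<in> set_compositions N" unfolding C_def by (rule level_sets_in_set_compositions[OF N])
  have N_eq: "N = (\<Union>j\<in>{..<length C}. C ! j)"
    unfolding set_compositionsD(1)[OF C, symmetric] set_conv_nth by blast
  have fin: "finite (C ! j)" if "j < length C" for j
    by (rule finite_subset[OF _ N], subst N_eq) (use that in blast)
  have disj: "\<forall>i\<in>{..<length C}. \<forall>j\<in>{..<length C}. i \<noteq> j \<longrightarrow> C ! i \<inter> C ! j = {}"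
    using set_compositionsD(3)[OF C] by blast
  have "(\<Prod>v\<in>N. var (f v)) = (\<Prod>j<length C. \<Prod>v\<in>C ! j. var (f v))"
    by (subst N_eq, rule prod.UNION_disjoint) (simp_all add: fin disj)
  also have "\<dots> = (\<Prod>j<length C. \<Prod>v\<in>C ! j. var (sorted_list_of_set (f ` N) ! j))"
    by (intro prod.cong refl) (simp add: C_def f_eq_nth_level[OF N])
  also have "\<dots> = (\<Prod>j < length (comp_type C). var (sorted_list_of_set (f ` N) ! j) ^ (comp_type C ! j))"
    by (intro prod.cong) (simp_all add: comp_type_def)
  finally show ?thesis .
qed

subsection \<open>D-partitions and D-set compositions\<close>

text \<open>The union of the first \<open>k\<close> blocks is where \<open>f\<close> takes one of
  its \<open>k\<close> smallest values, a down-set because \<open>f\<close> is weakly increasing. An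
  inversion inside a block would force a strict increase between equal values.\<close>

lemma level_sets_D_partition:
  assumes D: "is_double_poset D" and N: "finite (points D)" and f: "f \<in> D_partitions D"
  shows "level_sets (points D) f \<in> D_set_compositions D"
proof -
  let ?N = "points D" and ?s = "sorted_list_of_set (f ` points D)"
  have sub: "ord1 D \<subseteq> ?N \<times> ?N"
    using D by (auto simp: is_double_poset_def partial_order_on_def preorder_on_def)
  have s: "sorted_wrt (<) ?s" "set ?s = f ` ?N" using N by auto
  have "down_set1 D (\<Union>(set (take k (level_sets ?N f))))" for k
  proof -
    have eq: "\<Union>(set (take k (level_sets ?N f))) = {v \<in> ?N. f v \<in> set (take k ?s)}"
      by (auto simp: level_sets_def take_map)
    have "f i \<in> set (take k ?s)" if ij: "(i, j) \<in> ord1 D" and fj: "f j \<in> set (take k ?s)" for i j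
    proof -
      obtain a where a: "a < k" "a < length ?s" "?s ! a = f j"
        using fj unfolding in_set_conv_nth by auto
      have "i \<in> ?N" using ij sub by blast
      then obtain b where b: "b < length ?s" "?s ! b = f i"
        using s(2) by (metis imageI in_set_conv_nth)
      have "f i \<le> f j" using f ij by (auto simp: D_partitions_def)
      \<comment> \<open>If \<open>a < b\<close>, strict sortedness would give
        \<open>f j < f i\<close>.\<close>
      then have "b \<le> a"
        using a b sorted_wrt_nth_less[OF s(1), of a b] by force
      then show ?thesis using a b unfolding in_set_conv_nth by (auto intro!: exI[of _ b])
    qed
    then show ?thesis unfolding eq down_set1_def using sub by blast
  qed
  moreover have "\<not> inversion D m m'"
    if "B \<in> set (level_sets ?N f)" "m \<in> B" "m' \<in> B" for B m m'
  proof
    assume "inversion D m m'"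
    then have "f m < f m'" using f by (auto simp: D_partitions_def inversion_def)
    then show False using that by (auto simp: level_sets_def)
  qed
  ultimately show ?thesis
    using level_sets_in_set_compositions[OF N] by (auto simp: D_set_compositions_def)
qed

text \<open>This is the index set of the sum defining \<open>monomial_qsym\<close> for a type of
  length \<open>k\<close>.\<close>

definition increasing_lists :: "nat \<Rightarrow> nat list set" where
  "increasing_lists k = {xs. length xs = k \<and> sorted_wrt (<) xs \<and> (\<forall>i \<in> set xs. 1 \<le> i)}"

text \<open>The down-set condition places the block of \<open>i\<close> no later than the block of
  \<open>j\<close> whenever \<open>i\<close> lies below \<open>j\<close> in the first order, so
  increasing values along the blocks give weak monotonicity. An inversion cannot lie in one block,
  so its two blocks differ and the inequality is strict.\<close>

lemma D_partition_of_blocks: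
  assumes D: "is_double_poset D" and C: "C \<in> D_set_compositions D"
    and xs: "xs \<in> increasing_lists (length C)"
    and ext: "f \<in> extensional (points D)"
    and f: "\<And>j v. j < length C \<Longrightarrow> v \<in> C ! j \<Longrightarrow> f v = xs ! j"
  shows "f \<in> D_partitions D"
proof -
  let ?N = "points D"
  have sub: "ord1 D \<subseteq> ?N \<times> ?N"
    using D by (auto simp: is_double_poset_def partial_order_on_def preorder_on_def)
  have Cs: "C \<in> set_compositions ?N" using C by (simp add: D_set_compositions_def)
  have len: "length xs = length C" and sorted: "sorted_wrt (<) xs" and pos: "\<forall>i \<in> set xs. 1 \<le> i"
    using xs by (auto simp: increasing_lists_def)
  have block: "\<exists>j<length C. v \<in> C ! j" if "v \<in> ?N" for v
    using set_compositions_ex1_block[OF Cs that] by blast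
  have val: "f v \<in> {1..}" if "v \<in> ?N" for v
    using block[OF that] f pos len by auto
  have blocks: "\<exists>a b. a \<le> b \<and> b < length C \<and> i \<in> C ! a \<and> j \<in> C ! b"
    if ij: "(i, j) \<in> ord1 D" for i j
  proof -
    obtain b where b: "b < length C" "j \<in> C ! b" using block sub ij by blast
    \<comment> \<open>The prefix must include block \<open>b\<close> itself, hence
      \<open>Suc b\<close>.\<close>
    then have "j \<in> \<Union>(set (take (Suc b) C))"
      by (auto simp: take_Suc_conv_app_nth)
    moreover have "down_set1 D (\<Union>(set (take (Suc b) C)))"
      using C b(1) unfolding D_set_compositions_def by (auto simp: Suc_le_eq)
    ultimately have "i \<in> \<Union>(set (take (Suc b) C))"
      using ij unfolding down_set1_def by blast
    then obtain a where "a < Suc b" "i \<in> C ! a"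
      by (auto simp: in_set_conv_nth)
    then show ?thesis using b by (auto simp: less_Suc_eq_le)
  qed
  have mono: "f i \<le> f j" if ij: "(i, j) \<in> ord1 D" for i j
  proof -
    obtain a b where ab: "a \<le> b" "b < length C" "i \<in> C ! a" "j \<in> C ! b"
      using blocks[OF ij] by blast
    then have "f i = xs ! a" "f j = xs ! b" using f by auto
    then show ?thesis
      using ab sorted_wrt_nth_less[OF sorted, of a b] len by (cases "a = b") auto
  qed
  have strict: "f i < f j" if inv: "less1 D i j" "less2 D j i" for i j
  proof -
    obtain a b where ab: "a \<le> b" "b < length C" "i \<in> C ! a" "j \<in> C ! b"
      using blocks inv(1) unfolding less1_def by meson
    have "a \<noteq> b"
    proof
      assume "a = b"
      then have "\<exists>B\<in>set C. i \<in> B \<and> j \<in> B" using ab nth_mem by blast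
      then show False using C inv unfolding D_set_compositions_def inversion_def by blast
    qed
    moreover have "f i = xs ! a" "f j = xs ! b" using ab f by auto
    ultimately show ?thesis
      using ab sorted_wrt_nth_less[OF sorted, of a b] len by auto
  qed
  show ?thesis
    using ext val mono strict by (auto simp: D_partitions_def PiE_def)
qed

text \<open>Once the level sets are prescribed, a D-partition is determined by its list of values,
  and any strictly increasing list of positive integers can be assigned to the blocks of
  \<open>C\<close> in order.\<close>

lemma bij_betw_values:
  assumes D: "is_double_poset D" and N: "finite (points D)" and C: "C \<in> D_set_compositions D"
  shows "bij_betw (\<lambda>f. sorted_list_of_set (f ` points D))
    {f \<in> D_partitions D. level_sets (points D) f = C} (increasing_lists (length C))"
  unfolding bij_betw_def
proof
  let ?N = "points D"
  have Cs: "C \<in> set_compositions ?N" using C by (simp add: D_set_compositions_def)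
  show "inj_on (\<lambda>f. sorted_list_of_set (f ` ?N)) {f \<in> D_partitions D. level_sets ?N f = C}"
  proof (rule inj_onI, clarify)
    fix f f'
    assume f: "f \<in> D_partitions D" "f' \<in> D_partitions D" "C = level_sets ?N f"
      "level_sets ?N f' = level_sets ?N f"
      and eq: "sorted_list_of_set (f ` ?N) = sorted_list_of_set (f' ` ?N)"
    have "f v = f' v" if v: "v \<in> ?N" for v
    proof -
      obtain j where "j < length C" "v \<in> C ! j" using set_compositions_ex1_block[OF Cs v] by blast
      then show ?thesis using f_eq_nth_level[OF N] f eq by metis
    qed
    moreover have "f \<in> extensional ?N" "f' \<in> extensional ?N"
      using f by (auto simp: D_partitions_def PiE_def)
    ultimately show "f = f'" by (metis extensionalityI)
  qed
  show "(\<lambda>f. sorted_list_of_set (f ` ?N)) ` {f \<in> D_partitions D. level_sets ?N f = C}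
      = increasing_lists (length C)"
  proof safe
    fix f assume f: "f \<in> D_partitions D"
    then have "f ` ?N \<subseteq> {1..}" by (auto simp: D_partitions_def)
    then show "sorted_list_of_set (f ` ?N) \<in> increasing_lists (length (level_sets ?N f))"
      using N by (auto simp: increasing_lists_def level_sets_def)
  next
    fix xs assume xs: "xs \<in> increasing_lists (length C)"
    \<comment> \<open>The description picks the index of the unique block containing
      \<open>v\<close>; restricting to the points makes \<open>f\<close> extensional, as members of
      \<open>D_partitions\<close> must be.\<close>
    define f where "f = (\<lambda>v\<in>?N. xs ! (THE j. j < length C \<and> v \<in> C ! j))"
    have f: "f v = xs ! j" if "j < length C" "v \<in> C ! j" for j v
    proof -
      have v: "v \<in> ?N" using that set_compositionsD(1)[OF Cs] by auto
      have "(THE j. j < length C \<and> v \<in> C ! j) = j"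
        using set_compositions_ex1_block[OF Cs v] that by (intro the1_equality) auto
      then show ?thesis using v by (simp add: f_def)
    qed
    have "f \<in> extensional ?N" unfolding f_def by (rule restrict_extensional)
    then have "f \<in> D_partitions D"
      using f by (rule D_partition_of_blocks[OF D C xs])
    moreover have "sorted_list_of_set (f ` ?N) = xs" "level_sets ?N f = C"
      using sorted_list_of_set_image_of_blocks[OF Cs _ f] xs by (auto simp: increasing_lists_def)
    ultimately show "xs \<in> (\<lambda>f. sorted_list_of_set (f ` ?N)) `
        {f \<in> D_partitions D. level_sets ?N f = C}"
      by (intro image_eqI[of _ _ f]) simp_all
  qed
qed

text \<open>A strictly increasing list is determined by its set of entries, with sorting as the
  inverse, so these lists correspond to the subsets of \<open>{1..n}\<close> of size
  \<open>k\<close>.\<close>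

lemma card_increasing_lists_upto:
  "card {xs \<in> increasing_lists k. set xs \<subseteq> {1..n}} = n choose k"
proof -
  have "bij_betw set {xs \<in> increasing_lists k. set xs \<subseteq> {1..n}} {B. B \<subseteq> {1..n} \<and> card B = k}"
  proof (rule bij_betw_byWitness[where f' = sorted_list_of_set])
    show "\<forall>xs\<in>{xs \<in> increasing_lists k. set xs \<subseteq> {1..n}}. sorted_list_of_set (set xs) = xs"
      by (auto simp: increasing_lists_def strict_sorted_iff sorted_list_of_set.idem_if_sorted_distinct)
    show "set ` {xs \<in> increasing_lists k. set xs \<subseteq> {1..n}} \<subseteq> {B. B \<subseteq> {1..n} \<and> card B = k}"
      by (auto simp: increasing_lists_def strict_sorted_iff distinct_card)
    have fin: "finite B" if "B \<subseteq> {1..n}" for B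
      using that finite_atLeastAtMost by (rule finite_subset)
    show "\<forall>B\<in>{B. B \<subseteq> {1..n} \<and> card B = k}. set (sorted_list_of_set B) = B"
      using fin by (metis (no_types, lifting) mem_Collect_eq set_sorted_list_of_set)
    show "sorted_list_of_set ` {B. B \<subseteq> {1..n} \<and> card B = k}
        \<subseteq> {xs \<in> increasing_lists k. set xs \<subseteq> {1..n}}"
    proof
      fix xs assume "xs \<in> sorted_list_of_set ` {B. B \<subseteq> {1..n} \<and> card B = k}"
      then obtain B where B: "B \<subseteq> {1..n}" "card B = k" "xs = sorted_list_of_set B" by blast
      moreover have "\<forall>i\<in>B. 1 \<le> i" using B(1) by auto
      ultimately show "xs \<in> {xs \<in> increasing_lists k. set xs \<subseteq> {1..n}}"
        using fin[OF B(1)] by (simp add: increasing_lists_def)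
    qed
  qed
  then show ?thesis using n_subsets[of "{1..n}" k] by (simp add: bij_betw_same_card)
qed

text \<open>Reindexing along the bijection of \<open>bij_betw_values\<close> turns one sum into the
  other, the monomials agreeing by \<open>prod_var_level_sets\<close>.\<close>

lemma monomial_qsym_comp_type:
  assumes "is_double_poset D" and N: "finite (points D)" and "C \<in> D_set_compositions D"
  shows "formal_sum {f \<in> D_partitions D. level_sets (points D) f = C}
    (\<lambda>f. \<Prod>v\<in>points D. var (f v)) = monomial_qsym (comp_type C)"
  unfolding monomial_qsym_def
proof (rule formal_sum_reindex[where h = "\<lambda>f. sorted_list_of_set (f ` points D)"])
  show "bij_betw (\<lambda>f. sorted_list_of_set (f ` points D))
    {f \<in> D_partitions D. level_sets (points D) f = C}
    {xs. length xs = length (comp_type C) \<and> sorted_wrt (<) xs \<and> (\<forall>i \<in> set xs. 1 \<le> i)}"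
    using bij_betw_values[OF assms] by (simp add: increasing_lists_def comp_type_def)
  fix f assume "f \<in> {f \<in> D_partitions D. level_sets (points D) f = C}"
  then have C: "C = level_sets (points D) f" by simp
  show "(\<Prod>v\<in>points D. var (f v)) = (\<Prod>j < length (comp_type C).
      var (sorted_list_of_set (f ` points D) ! j) ^ (comp_type C ! j))"
    by (simp only: C prod_var_level_sets[OF N])
qed

text \<open>The bijection of \<open>bij_betw_values\<close> restricts to bounded D-partitions, since
  the bound on \<open>f\<close> is exactly a bound on the entries of its value list.\<close>

lemma card_D_partitions_upto_level_sets:
  assumes "is_double_poset D" and N: "finite (points D)" and "C \<in> D_set_compositions D"
  shows "card {f \<in> D_partitions_upto D n. level_sets (points D) f = C} = n choose length C"
proof -
  let ?h = "\<lambda>f. sorted_list_of_set (f ` points D)"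
  have bij: "bij_betw ?h {f \<in> D_partitions D. level_sets (points D) f = C}
      (increasing_lists (length C))"
    by (rule bij_betw_values[OF assms])
  have "{f \<in> D_partitions_upto D n. level_sets (points D) f = C} =
      {f \<in> {f \<in> D_partitions D. level_sets (points D) f = C}. set (?h f) \<subseteq> {1..n}}"
    using N by (auto simp: D_partitions_upto_def)
  moreover have "bij_betw ?h \<dots> {xs \<in> increasing_lists (length C). set xs \<subseteq> {1..n}}"
    using bij by (rule bij_betw_Collect) simp
  ultimately have "card {f \<in> D_partitions_upto D n. level_sets (points D) f = C} =
      card {xs \<in> increasing_lists (length C). set xs \<subseteq> {1..n}}"
    by (simp add: bij_betw_same_card)
  then show ?thesis by (simp only: card_increasing_lists_upto)
qed

subsection \<open>Characters\<close>

lemma perm_char_eq_card: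
  assumes "finite X"
  shows "perm_char \<phi> X g = of_nat (card {x \<in> X. \<phi> g x = x})"
  using assms by (simp add: perm_char_def sum.If_cases Int_def eq_commute)

lemma finite_D_set_compositions:
  "finite (points D) \<Longrightarrow> finite (D_set_compositions D)"
  by (rule finite_subset[OF _ finite_set_compositions]) (auto simp: D_set_compositions_def)

text \<open>The value of \<open>D_char\<close> counts the fixed compositions of one type, so this is
  grouping by type. The weight \<open>w\<close> is left general to serve both for coefficients of
  \<open>monomial_qsym\<close> and for binomial coefficients.\<close>

lemma sum_D_char:
  assumes N: "finite (points D)"
  shows "(\<Sum>\<alpha> \<in> compositions (card (points D)). D_char D \<alpha> g * w \<alpha>) =
    (\<Sum>C \<in> {C \<in> D_set_compositions D. act_comp g C = C}. w (comp_type C))"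
proof -
  let ?K = "{C \<in> D_set_compositions D. act_comp g C = C}"
  have fin: "finite (D_set_compositions D)" by (rule finite_D_set_compositions[OF N])
  then have finK: "finite ?K" by simp
  have type: "comp_type ` ?K \<subseteq> compositions (card (points D))"
    by (intro image_subsetI comp_type_in_compositions[OF N]) (simp add: D_set_compositions_def)
  have "(\<Sum>C\<in>?K. w (comp_type C)) =
      (\<Sum>\<alpha> \<in> compositions (card (points D)). \<Sum>C\<in>{C \<in> ?K. comp_type C = \<alpha>}. w (comp_type C))"
    by (rule sum.group[OF finK finite_compositions type, symmetric])
  also have "\<dots> = (\<Sum>\<alpha> \<in> compositions (card (points D)). D_char D \<alpha> g * w \<alpha>)"
  proof (rule sum.cong[OF refl])
    fix \<alpha>
    have "{C \<in> ?K. comp_type C = \<alpha>} = {C \<in> D_set_compositions_of_type D \<alpha>. act_comp g C = C}"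
      by (auto simp: D_set_compositions_of_type_def)
    moreover have "finite (D_set_compositions_of_type D \<alpha>)"
      using fin by (simp add: D_set_compositions_of_type_def)
    ultimately show "(\<Sum>C\<in>{C \<in> ?K. comp_type C = \<alpha>}. w (comp_type C)) = D_char D \<alpha> g * w \<alpha>"
      by (simp add: D_char_def perm_char_eq_card D_set_compositions_of_type_def)
  qed
  finally show ?thesis by simp
qed

text \<open>The left action composes with the inverse of \<open>g\<close>, whereas
  \<open>\<Omega>\<close> asks for invariance under \<open>g\<close> itself. The two agree because a
  function is invariant under a bijection exactly when it is invariant under the inverse.\<close>

lemma act_fun_fixed_iff:
  assumes g: "g \<in> Bij (points D)" and f: "f \<in> extensional (points D)"
  shows "act_fun D g f = f \<longleftrightarrow> compose (points D) f g = f"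
proof -
  let ?N = "points D"
  have bij: "bij_betw g ?N ?N" using g by (simp add: Bij_def)
  have "act_fun D g f = f \<longleftrightarrow> (\<forall>v\<in>?N. f (inv_into ?N g v) = f v)"
    using f by (auto simp: act_fun_def inv_BijGroup[OF g] compose_def fun_eq_iff extensional_def)
  also have "\<dots> \<longleftrightarrow> (\<forall>v\<in>?N. f (g v) = f v)"
  proof
    assume inv: "\<forall>v\<in>?N. f (inv_into ?N g v) = f v"
    show "\<forall>v\<in>?N. f (g v) = f v"
    proof
      fix v assume v: "v \<in> ?N"
      then have "f (inv_into ?N g (g v)) = f (g v)" using inv bij_betwE[OF bij] by blast
      then show "f (g v) = f v" using bij_betw_inv_into_left[OF bij v] by simp
    qed
  next
    assume inv: "\<forall>v\<in>?N. f (g v) = f v"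
    show "\<forall>v\<in>?N. f (inv_into ?N g v) = f v"
    proof
      fix v assume v: "v \<in> ?N"
      then have "f (g (inv_into ?N g v)) = f (inv_into ?N g v)"
        using inv bij_betwE[OF bij_betw_inv_into[OF bij]] by blast
      then show "f (inv_into ?N g v) = f v" using bij_betw_inv_into_right[OF bij v] by simp
    qed
  qed
  also have "\<dots> \<longleftrightarrow> compose ?N f g = f"
    using f by (auto simp: compose_def fun_eq_iff extensional_def)
  finally show ?thesis .
qed

lemma compose_fixed_iff_level_sets_fixed:
  assumes "finite (points D)" "g \<in> Bij (points D)" "f \<in> D_partitions D"
  shows "compose (points D) f g = f \<longleftrightarrow>
    act_comp g (level_sets (points D) f) = level_sets (points D) f"
  using act_comp_level_sets[of "points D" f g] assms by (auto simp: D_partitions_def PiE_def)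

section \<open>Identities summed over the fixed D-set compositions\<close>

lemma \<Omega>_eq_sum_monomial_qsym:
  assumes D: "is_double_poset D" and N: "finite (points D)" and g: "g \<in> Bij (points D)"
  shows "\<Omega> D g =
    (\<Sum>C \<in> {C \<in> D_set_compositions D. act_comp g C = C}. monomial_qsym (comp_type C))"
proof -
  let ?N = "points D" and ?K = "{C \<in> D_set_compositions D. act_comp g C = C}"
  let ?P = "{f \<in> D_partitions D. compose (points D) f g = f}"
  note fixed = compose_fixed_iff_level_sets_fixed[OF N g]
  have "\<Omega> D g = (\<Sum>C\<in>?K. formal_sum {f \<in> ?P. level_sets ?N f = C} (\<lambda>f. \<Prod>v\<in>?N. var (f v)))"
    unfolding \<Omega>_def
  proof (rule formal_sum_group)
    show "finite {f \<in> ?P. Poly_Mapping.lookup (\<Prod>v\<in>?N. var (f v)) m \<noteq> 0}" for m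
      by (rule finite_subset[OF _ finite_prod_var_fiber[OF N, of "{1..}" m]])
        (auto simp: D_partitions_def)
    show "level_sets ?N ` ?P \<subseteq> ?K"
      using level_sets_D_partition[OF D N] fixed by auto
  qed (use finite_D_set_compositions[OF N] in auto)
  also have "\<dots> = (\<Sum>C\<in>?K. monomial_qsym (comp_type C))"
  proof (rule sum.cong[OF refl])
    fix C assume C: "C \<in> ?K"
    \<comment> \<open>Invariance under \<open>g\<close> depends only on the level sets, so over a
      fixed \<open>C\<close> the whole fiber of D-partitions is invariant.\<close>
    then have "{f \<in> ?P. level_sets ?N f = C} = {f \<in> D_partitions D. level_sets ?N f = C}"
      using fixed by auto
    then show "formal_sum {f \<in> ?P. level_sets ?N f = C} (\<lambda>f. \<Prod>v\<in>?N. var (f v)) =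
        monomial_qsym (comp_type C)"
      using monomial_qsym_comp_type[OF D N] C by simp
  qed
  finally show ?thesis .
qed

lemma \<Omega>_poly_eq_sum_binomial:
  assumes D: "is_double_poset D" and N: "finite (points D)" and g: "g \<in> Bij (points D)"
  shows "\<Omega>_poly D n g =
    (\<Sum>C \<in> {C \<in> D_set_compositions D. act_comp g C = C}. of_nat (n choose length C))"
proof -
  let ?N = "points D" and ?K = "{C \<in> D_set_compositions D. act_comp g C = C}"
  let ?P = "{f \<in> D_partitions_upto D n. act_fun D g f = f}"
  have fixed: "act_fun D g f = f \<longleftrightarrow> act_comp g (level_sets ?N f) = level_sets ?N f"
    if "f \<in> D_partitions D" for f
    using act_fun_fixed_iff[OF g] compose_fixed_iff_level_sets_fixed[OF N g that] that
    by (auto simp: D_partitions_def PiE_def)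
  have sub: "D_partitions_upto D n \<subseteq> D_partitions D" by (auto simp: D_partitions_upto_def)
  have fin: "finite (D_partitions_upto D n)"
  proof (rule finite_subset)
    show "D_partitions_upto D n \<subseteq> ?N \<rightarrow>\<^sub>E {1..n}"
      by (auto simp: D_partitions_upto_def D_partitions_def)
  qed (use N in \<open>simp add: finite_PiE\<close>)
  then have finP: "finite ?P" by simp
  have finK: "finite ?K" using finite_D_set_compositions[OF N] by simp
  have levels: "level_sets ?N ` ?P \<subseteq> ?K"
  proof (rule image_subsetI)
    fix f assume f: "f \<in> ?P"
    then have "f \<in> D_partitions D" using sub by blast
    then show "level_sets ?N f \<in> ?K" using level_sets_D_partition[OF D N] fixed f by simp
  qed
  have "card ?P = (\<Sum>C\<in>?K. card {f \<in> ?P. level_sets ?N f = C})"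
    \<comment> \<open>With constant weight 1, grouping becomes counting by fibers.\<close>
    using sum.group[OF finP finK levels, of "\<lambda>_. 1::nat"] by simp
  also have "\<dots> = (\<Sum>C\<in>?K. n choose length C)"
  proof (rule sum.cong[OF refl])
    fix C assume C: "C \<in> ?K"
    then have "{f \<in> ?P. level_sets ?N f = C} = {f \<in> D_partitions_upto D n. level_sets ?N f = C}"
      using fixed sub by auto
    then show "card {f \<in> ?P. level_sets ?N f = C} = n choose length C"
      using card_D_partitions_upto_level_sets[OF D N] C by simp
  qed
  finally show ?thesis by (simp add: \<Omega>_poly_def perm_char_eq_card[OF fin])
qed

theorem theorem3p2:
  fixes D :: "'a double_poset" and G :: "('a \<Rightarrow> 'a) set"
  assumes "is_double_poset D"
    and "finite (points D)"
    and "subgroup G (BijGroup (points D))"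
    and "G \<subseteq> Aut D"
  shows "(\<forall>g \<in> G. \<Omega> D g =
            (\<Sum>C \<in> {C \<in> D_set_compositions D. act_comp g C = C}. monomial_qsym (comp_type C))) \<and>
         (\<forall>g \<in> G. \<Omega> D g =
            (\<Sum>\<alpha> \<in> compositions (card (points D)). D_char D \<alpha> g *\<^sub>s monomial_qsym \<alpha>)) \<and>
         (\<forall>n \<ge> 1. \<forall>g \<in> G. \<Omega>_poly D n g =
            (\<Sum>\<alpha> \<in> compositions (card (points D)). D_char D \<alpha> g * of_nat (n choose length \<alpha>)))"
proof (intro conjI ballI allI impI)
  fix g assume "g \<in> G"
  then have g: "g \<in> Bij (points D)" using assms(4) by (auto simp: Aut_def)
  show \<Omega>: "\<Omega> D g =
      (\<Sum>C \<in> {C \<in> D_set_compositions D. act_comp g C = C}. monomial_qsym (comp_type C))"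
    by (rule \<Omega>_eq_sum_monomial_qsym[OF assms(1,2) g])
  show "\<Omega> D g = (\<Sum>\<alpha> \<in> compositions (card (points D)). D_char D \<alpha> g *\<^sub>s monomial_qsym \<alpha>)"
    \<comment> \<open>The first identity is regrouped by type one coefficient at a time:
      \<open>sum_D_char\<close> is used with \<open>w \<alpha>\<close> the coefficient of
      \<open>monomial_qsym \<alpha>\<close> at a given exponent vector.\<close>
    unfolding \<Omega>
    by (rule ext) (simp add: sum_fun_apply scale_series_def sum_D_char[OF assms(2)])
  show "\<Omega>_poly D n g =
      (\<Sum>\<alpha> \<in> compositions (card (points D)). D_char D \<alpha> g * of_nat (n choose length \<alpha>))" for n
    using \<Omega>_poly_eq_sum_binomial[OF assms(1,2) g, of n]
      sum_D_char[OF assms(2), of g "\<lambda>\<alpha>. of_nat (n choose length \<alpha>)"]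
    by (simp add: comp_type_def)
qed

end
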